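(* Let $n\ge 2$, $m\ge 1$ and $d\ge 1$ be integers, let $\mathbf{p}_0,\dots,\mathbf{p}_n\in\mathbb{R}^d$, and let $\omega_0,\dots,\omega_n$ be positive real numbers with $\omega_0=\omega_n=1$. Let $k$, $h$, the fixed endpoint control points $\mathbf{q}_i$ ($0\le i\le k$ and $m-h\le i\le m$), and the numbers $W_0,\dots,W_{2n}$ be as defined in the context. Then each of the following two linear systems in the unknowns $\mathbf{q}_{k+1},\dots,\mathbf{q}_{m-h-1}\in\mathbb{R}^d$ has a unique solution. (a) (Weight $\rho(t)=\omega(t)$.) For $l=k+1,k+2,\dots,m-h-1$: $$\sum_{i=k+1}^{m-h-1}\sum_{j=0}^{n}\frac{\binom{n}{j}\binom{m}{i}}{\binom{2m+n}{i+j+l}}\omega_j\mathbf{q}_i=\frac{2m+n+1}{m+n+1}\sum_{i=0}^{n}\frac{\binom{n}{i}}{\binom{m+n}{i+l}}\omega_i\mathbf{p}_i-\sum_{i=0}^{k}\sum_{j=0}^{n}\frac{\binom{n}{j}\binom{m}{i}}{\binom{2m+n}{i+j+l}}\omega_j\mathbf{q}_i-\sum_{i=m-h}^{m}\sum_{j=0}^{n}\frac{\binom{n}{j}\binom{m}{i}}{\binom{2m+n}{i+j+l}}\omega_j\mathbf{q}_i .$$ (b) (Weight $\rho(t)=\omega(t)^2$.) For $l=k+1,k+2,\dots,m-h-1$: $$\sum_{i=k+1}^{m-h-1}\sum_{j=0}^{2n}\frac{\binom{2n}{j}\binom{m}{i}}{\binom{2n+2m}{i+j+l}}W_j\mathbf{q}_i=\frac{2m+2n+1}{m+2n+1}\sum_{i=0}^{n}\sum_{j=0}^{n}\frac{\binom{n}{i}\binom{n}{j}}{\binom{2n+m}{i+j+l}}\omega_i\omega_j\mathbf{p}_i-\sum_{i=0}^{k}\sum_{j=0}^{2n}\frac{\binom{2n}{j}\binom{m}{i}}{\binom{2n+2m}{i+j+l}}W_j\mathbf{q}_i-\sum_{i=m-h}^{m}\sum_{j=0}^{2n}\frac{\binom{2n}{j}\binom{m}{i}}{\binom{2n+2m}{i+j+l}}W_j\mathbf{q}_i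 .$$
   Context: Bernstein polynomials: $B_i^n(t)=\binom{n}{i}t^i(1-t)^{n-i}$. The data define the rational Bézier curve $\mathbf{P}(t)=\mathbf{x}(t)/\omega(t)$, $t\in[0,1]$, where $\mathbf{x}(t)=\sum_{i=0}^n\omega_i\mathbf{p}_iB_i^n(t)$ and $\omega(t)=\sum_{i=0}^n\omega_iB_i^n(t)>0$. The curve $\mathbf{Q}(t)=\sum_{i=0}^mB_i^m(t)\mathbf{q}_i$ is the approximating polynomial Bézier curve of degree $m$. The systems (a) and (b) express the conditions $\int_0^1(\mathbf{x}(t)-\omega(t)\mathbf{Q}(t))B_l^m(t)\frac{\rho(t)}{\omega(t)}\,dt=0$ for $l=k+1,\dots,m-h-1$, with $\rho=\omega$ and $\rho=\omega^2$ respectively. These are the stationarity conditions, in the free control points, for $d_\rho(\mathbf{P},\mathbf{Q})=\int_0^1\rho(t)\|\mathbf{P}(t)-\mathbf{Q}(t)\|^2dt$. The integers $k,h$ are determined by $m$: $k=0$ if $m=1$, $k=1$ if $m\in\{2,3\}$, $k=2$ if $m\ge4$; $h=0$ if $m\in\{1,2\}$, $h=1$ if $m\in\{3,4\}$, $h=2$ if $m\ge5$. If $k+1>m-h-1$ there are no unknowns and no equations, and the system is considered (trivially) uniquely solvable. The fixed endpoint control points (obtained by matching values and derivatives of $\mathbf{P}$ and $\mathbf{Q}$ at $t=0$ and $t=1$) are: $\mathbf{q}_0=\mathbf{p}_0$, $\mathbf{q}_m=\mathbf{p}_n$; if $m\ge2$, $\mathbf{q}_1=\frac{n}{m}\omega_1\mathbf{p}_1+\left(1-\frac{n}{m}\omega_1\right)\mathbf{p}_0$;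 if $m\ge3$, $\mathbf{q}_{m-1}=\left(1-\frac{n}{m}\omega_{n-1}\right)\mathbf{p}_n+\frac{n}{m}\omega_{n-1}\mathbf{p}_{n-1}$; if $m\ge4$, $\mathbf{q}_2=\frac{1}{m(m-1)}\{n(n-1)\omega_2\mathbf{p}_2+2n\omega_1(m-n\omega_1)\mathbf{p}_1+[m(m-1)+2n\omega_1(n\omega_1-m)+n\omega_2(1-n)]\mathbf{p}_0\}$; if $m\ge5$, $\mathbf{q}_{m-2}=\frac{1}{m(m-1)}\{[2n\omega_{n-1}(n\omega_{n-1}-m)+n\omega_{n-2}(1-n)+m(m-1)]\mathbf{p}_n+2n\omega_{n-1}(m-n\omega_{n-1})\mathbf{p}_{n-1}+n(n-1)\omega_{n-2}\mathbf{p}_{n-2}\}$. For $0\le i\le 2n$, $$W_i=\sum_{j=\max(0,i-n)}^{\min(n,i)}\frac{\binom{n}{j}\binom{n}{i-j}}{\binom{2n}{i}}\omega_{i-j}\omega_j,$$ i.e. the $W_i$ are the Bernstein coefficients of $\omega(t)^2$ in degree $2n$. *)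

theory Defs
  imports "HOL-Analysis.Analysis"
begin

definition left_order :: "nat \<Rightarrow> nat" where
  "left_order m = (if m \<le> 1 then 0 else if m \<le> 3 then 1 else 2)"

definition right_order :: "nat \<Rightarrow> nat" where
  "right_order m = (if m \<le> 2 then 0 else if m \<le> 4 then 1 else 2)"

text \<open>
  The control points of the polynomial curve of degree m that are fixed by the
  endpoint conditions. For m at least 1 the guards of the branches are mutually
  exclusive, and the indices they cover are exactly those up to \<open>left_order m\<close>
  together with those from \<open>m - right_order m\<close> to m. The last branch is a dummy value
  for all other indices.
\<close>

definition fixed_ctrl_pt ::
  "nat \<Rightarrow> nat \<Rightarrow> (nat \<Rightarrow> real) \<Rightarrow> (nat \<Rightarrow> real ^ 'd) \<Rightarrow> nat \<Rightarrow> real ^ 'd" where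
  "fixed_ctrl_pt n m \<omega> p i =
    (if i = 0 then p 0
     else if i = m then p n
     else if i = 1 \<and> m \<ge> 2 then
       (real n / real m * \<omega> 1) *\<^sub>R p 1 + (1 - real n / real m * \<omega> 1) *\<^sub>R p 0
     else if i = m - 1 \<and> m \<ge> 3 then
       (1 - real n / real m * \<omega> (n - 1)) *\<^sub>R p n
         + (real n / real m * \<omega> (n - 1)) *\<^sub>R p (n - 1)
     else if i = 2 \<and> m \<ge> 4 then
       (1 / (real m * (real m - 1))) *\<^sub>R
         ((real n * (real n - 1) * \<omega> 2) *\<^sub>R p 2
          + (2 * real n * \<omega> 1 * (real m - real n * \<omega> 1)) *\<^sub>R p 1
          + (real m * (real m - 1) + 2 * real n * \<omega> 1 * (real n * \<omega> 1 - real m)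
              + real n * \<omega> 2 * (1 - real n)) *\<^sub>R p 0)
     else if i = m - 2 \<and> m \<ge> 5 then
       (1 / (real m * (real m - 1))) *\<^sub>R
         ((2 * real n * \<omega> (n - 1) * (real n * \<omega> (n - 1) - real m)
              + real n * \<omega> (n - 2) * (1 - real n) + real m * (real m - 1)) *\<^sub>R p n
          + (2 * real n * \<omega> (n - 1) * (real m - real n * \<omega> (n - 1))) *\<^sub>R p (n - 1)
          + (real n * (real n - 1) * \<omega> (n - 2)) *\<^sub>R p (n - 2))
     else 0)"

text \<open>
  Bernstein coefficients, in degree 2n, of the square of the polynomial with
  Bernstein coefficients \<open>\<omega> 0, \<dots>, \<omega> n\<close>. The lower summation bound max(0, i - n)
  is the truncated subtraction on natural numbers.
\<close>

definition sq_weight :: "nat \<Rightarrow> (nat \<Rightarrow> real) \<Rightarrow> nat \<Rightarrow> real" where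
  "sq_weight n \<omega> i =
    (\<Sum>j = i - n..min n i.
       real (n choose j) * real (n choose (i - j)) / real ((2 * n) choose i)
         * \<omega> (i - j) * \<omega> j)"

end

theory Submission
  imports Defs
begin

text \<open>
  Both systems are normal equations of a least-squares problem, so their matrices are, up to
  scaling, Gram matrices of linearly independent polynomials. With \<open>N = 2*m + r\<close>, the Beta
  integral gives
  \<open>1 / (N choose s) = (N + 1) * \<integral> t^s * (1 - t)^(N - s) dt\<close> over [0,1]. Splitting the exponents
  for \<open>s = i + j + l\<close> shows that the entry of the matrix in row l and column i is
  \<open>(N + 1) * (m choose i) * \<integral> e l * e i * w dt\<close>, where \<open>e i = t^i * (1 - t)^(m - i)\<close> and w is
  the polynomial whose Bernstein coefficients in degree r are the weights: \<open>\<omega>\<close> with \<open>r = n\<close> in the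
  first system, \<open>\<omega>\<^sup>2\<close> with \<open>r = 2*n\<close> in the second. The weights are positive, so w is positive
  on (0,1), and a zero of the quadratic form is a polynomial \<open>\<Sum>i. y i * e i\<close> that
  vanishes on [0,1]; the \<open>e i\<close> being independent, y is zero
  (\<open>bernstein_quadratic_form_eq_0\<close>).

  The same argument applies to every principal submatrix. A square system all of whose principal
  submatrices are nonsingular is solvable by elimination without pivoting
  (\<open>linear_system_solvable\<close>), whatever its right-hand side. The prescribed endpoint control
  points and the curve to be approximated enter only through the right-hand side.
\<close>

section \<open>Bernstein moments\<close>

lemma has_integral_monomial_unit_interval:
  assumes "s \<le> N"
  shows "((\<lambda>t::real. t ^ s * (1 - t) ^ (N - s)) has_integral
           1 / (real (N + 1) * real (N choose s))) {0..1}"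
proof -
  have "Beta (real s + 1) (real (N - s) + 1) = fact s * fact (N - s) / fact (N + 1)"
  proof -
    have "real s + 1 + (real (N - s) + 1) = 1 + real (N + 1)"
      using assms by simp
    then show ?thesis
      unfolding Beta_def by (simp only: Gamma_fact add.commute[of _ 1])
  qed
  also have "\<dots> = 1 / (real (N + 1) * real (N choose s))"
    using assms by (simp add: binomial_fact field_simps)
  finally have *: "Beta (real s + 1) (real (N - s) + 1) = 1 / (real (N + 1) * real (N choose s))" .
  have "((\<lambda>t. t powr (real s + 1 - 1) * (1 - t) powr (real (N - s) + 1 - 1))
          has_integral Beta (real s + 1) (real (N - s) + 1)) {0..1}"
    by (rule has_integral_Beta_real) auto
  then show ?thesis
    unfolding *
    \<comment> \<open>Real and natural powers differ at the endpoints, because \<open>0 powr 0 = 0\<close>.\<close>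
    by (rule has_integral_spike_finite[where S = "{0, 1}", rotated 2])
      (simp_all add: powr_realpow)
qed

text \<open>
  Dividing by \<open>(1 - t)^m\<close> turns the combination into an ordinary polynomial in \<open>t / (1 - t)\<close>, a
  quantity that takes every positive value, so this polynomial has infinitely many roots.
\<close>

lemma bernstein_combination_eq_0:
  fixes y :: "nat \<Rightarrow> real"
  assumes J: "J \<subseteq> {..m}"
    and zero: "\<And>t. 0 < t \<Longrightarrow> t < 1 \<Longrightarrow> (\<Sum>i\<in>J. y i * (t ^ i * (1 - t) ^ (m - i))) = 0"
    and "i \<in> J"
  shows "y i = 0"
proof -
  define z where "z i = (if i \<in> J then y i else 0)" for i
  have root: "(\<Sum>i\<le>m. z i * s ^ i) = 0" if "s > 0" for s :: real
  proof -
    define t where "t = s / (1 + s)"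
    have t: "0 < t" "t < 1" "s = t / (1 - t)"
      using that by (auto simp: t_def field_simps)
    have "(\<Sum>i\<le>m. z i * s ^ i) = (\<Sum>i\<in>J. y i * s ^ i)"
      using J by (intro sum.mono_neutral_cong_right) (auto simp: z_def)
    also have "\<dots> = (\<Sum>i\<in>J. y i * (t ^ i * (1 - t) ^ (m - i))) / (1 - t) ^ m"
      unfolding sum_divide_distrib
    proof (rule sum.cong)
      fix i assume "i \<in> J"
      then have "(1 - t) ^ m = (1 - t) ^ i * (1 - t) ^ (m - i)"
        using J by (auto simp: subset_iff simp flip: power_add)
      then show "y i * s ^ i = y i * (t ^ i * (1 - t) ^ (m - i)) / (1 - t) ^ m"
        using t by (simp add: power_divide)
    qed simp
    finally show ?thesis using zero t by simp
  qed
  have "{0::real<..} \<subseteq> {s. (\<Sum>i\<le>m. z i * s ^ i) = 0}"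
    using root by auto
  then have "infinite {s::real. (\<Sum>i\<le>m. z i * s ^ i) = 0}"
    using infinite_Ioi finite_subset by blast
  then have "\<forall>i\<le>m. z i = 0"
    using polyfun_finite_roots[of z m] by blast
  then show ?thesis
    using J \<open>i \<in> J\<close> by (metis atMost_iff subsetD z_def)
qed

text \<open>
  Up to the factor \<open>2*m + r + 1\<close>, the form is the integral over [0,1] of \<open>u\<^sup>2 * w\<close>, where u is the
  combination of the \<open>t^i * (1 - t)^(m - i)\<close> with coefficients y and w is the weight polynomial.
  This integrand is continuous and nonnegative, hence identically zero, and w does not vanish
  inside the interval.
\<close>

lemma bernstein_quadratic_form_eq_0:
  fixes c y :: "nat \<Rightarrow> real"
  assumes J: "J \<subseteq> {..m}"
    and c: "\<And>j. j \<le> r \<Longrightarrow> c j > 0"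
    and form: "(\<Sum>l\<in>J. \<Sum>i\<in>J. y l * y i *
        (\<Sum>j\<le>r. real (r choose j) * c j / real ((2*m + r) choose (i + j + l)))) = 0"
    and "i \<in> J"
  shows "y i = 0"
proof -
  define N where "N = 2*m + r"
  define u where "u t = (\<Sum>i\<in>J. y i * (t ^ i * (1 - t) ^ (m - i)))" for t :: real
  define w where "w t = (\<Sum>j\<le>r. real (r choose j) * c j * (t ^ j * (1 - t) ^ (r - j)))" for t :: real
  have fin: "finite J" using J finite_subset by blast
  have expand: "(\<Sum>l\<in>J. \<Sum>i\<in>J. y l * y i * (\<Sum>j\<le>r. real (r choose j) * c j *
      (t ^ (i + j + l) * (1 - t) ^ (N - (i + j + l))))) = (u t)\<^sup>2 * w t" for t
  proof -
    have mono: "t ^ (i + j + l) * (1 - t) ^ (N - (i + j + l)) =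
        (t ^ l * (1 - t) ^ (m - l)) * (t ^ i * (1 - t) ^ (m - i)) * (t ^ j * (1 - t) ^ (r - j))"
      if "l \<in> J" "i \<in> J" "j \<le> r" for i j l
    proof -
      have "N - (i + j + l) = (m - l) + (m - i) + (r - j)"
        using that J[THEN subsetD, of l] J[THEN subsetD, of i] unfolding N_def atMost_iff by linarith
      then show ?thesis by (simp add: power_add)
    qed
    have "(\<Sum>l\<in>J. \<Sum>i\<in>J. y l * y i * (\<Sum>j\<le>r. real (r choose j) * c j *
        (t ^ (i + j + l) * (1 - t) ^ (N - (i + j + l))))) =
      (\<Sum>l\<in>J. \<Sum>i\<in>J. (y l * (t ^ l * (1 - t) ^ (m - l))) * (y i * (t ^ i * (1 - t) ^ (m - i))) * w t)"
      by (intro sum.cong refl) (simp add: w_def sum_distrib_left mono mult_ac)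
    also have "\<dots> = (u t)\<^sup>2 * w t"
      unfolding u_def power2_eq_square sum_product by (simp only: sum_distrib_right)
    finally show ?thesis .
  qed
  have degree: "i + j + l \<le> N" if "l \<in> J" "i \<in> J" "j \<le> r" for i j l
    using that J[THEN subsetD, of l] J[THEN subsetD, of i] unfolding N_def atMost_iff by linarith
  have "((\<lambda>t. \<Sum>l\<in>J. \<Sum>i\<in>J. y l * y i * (\<Sum>j\<le>r. real (r choose j) * c j *
      (t ^ (i + j + l) * (1 - t) ^ (N - (i + j + l))))) has_integral
      (\<Sum>l\<in>J. \<Sum>i\<in>J. y l * y i * (\<Sum>j\<le>r. real (r choose j) * c j *
        (1 / (real (N + 1) * real (N choose (i + j + l))))))) {0..1}"
    by (intro has_integral_sum has_integral_mult_right has_integral_monomial_unit_interval)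
      (simp_all add: fin degree)
  also have "(\<Sum>l\<in>J. \<Sum>i\<in>J. y l * y i * (\<Sum>j\<le>r. real (r choose j) * c j *
        (1 / (real (N + 1) * real (N choose (i + j + l)))))) =
      (1 / real (N + 1)) * (\<Sum>l\<in>J. \<Sum>i\<in>J. y l * y i *
        (\<Sum>j\<le>r. real (r choose j) * c j / real (N choose (i + j + l))))"
    by (simp add: sum_distrib_left mult_ac)
  also have "\<dots> = 0" using form by (simp add: N_def)
  finally have "((\<lambda>t. (u t)\<^sup>2 * w t) has_integral 0) {0..1}"
    by (simp only: expand)
  then have int: "integral {0..1} (\<lambda>t. (u t)\<^sup>2 * w t) = 0"
    by (rule integral_unique)
  have w_nonneg: "w t \<ge> 0" if "t \<in> {0..1}" for t
    unfolding w_def using that c by (intro sum_nonneg mult_nonneg_nonneg) (auto simp: less_imp_le)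
  have cont: "continuous_on {0..1} (\<lambda>t. (u t)\<^sup>2 * w t)"
    unfolding u_def w_def by (intro continuous_intros)
  have prod0: "(u t)\<^sup>2 * w t = 0" if "t \<in> {0..1}" for t
    using integral_eq_0_iff[OF cont] int w_nonneg that by auto
  have "u t = 0" if "0 < t" "t < 1" for t
  proof -
    have "w t > 0"
      unfolding w_def using that c by (intro sum_pos) auto
    then show ?thesis using prod0[of t] that by simp
  qed
  then show ?thesis
    using bernstein_combination_eq_0[OF J _ \<open>i \<in> J\<close>, of y] by (simp add: u_def)
qed

section \<open>Linear systems with nonsingular principal subsystems\<close>

text \<open>
  Induction on the index set, eliminating one unknown at a time. If u solves the smaller system
  with right-hand side b and v the one whose right-hand side is column a, then \<open>u - d * v\<close>,
  extended by d at a, satisfies the old equations for every d. The new equation determines d as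
  long as the Schur complement \<open>s\<close> is nonzero. It is, because otherwise \<open>- v\<close>, extended by 1 at a,
  would be a kernel vector. Assuming nonsingularity of every principal submatrix makes the
  hypothesis pass to subsets of the index set.
\<close>

lemma linear_system_solvable:
  fixes A :: "nat \<Rightarrow> nat \<Rightarrow> real" and b :: "nat \<Rightarrow> real"
  assumes "finite I"
    and "\<And>J x. J \<subseteq> I \<Longrightarrow> (\<And>l. l \<in> J \<Longrightarrow> (\<Sum>i\<in>J. A l i * x i) = 0) \<Longrightarrow> (\<And>i. i \<in> J \<Longrightarrow> x i = 0)"
  shows "\<exists>x. \<forall>l\<in>I. (\<Sum>i\<in>I. A l i * x i) = b l"
  using assms
proof (induction I arbitrary: b rule: finite_induct)
  case empty
  then show ?case by simp
next
  case (insert a I)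
  have solvable: "\<exists>x. \<forall>l\<in>I. (\<Sum>i\<in>I. A l i * x i) = b l" for b
  proof (rule insert.IH)
    fix J x i
    assume "J \<subseteq> I" and "i \<in> J" and "\<And>l. l \<in> J \<Longrightarrow> (\<Sum>i\<in>J. A l i * x i) = 0"
    then show "x i = 0"
      by (intro insert.prems[of J x i]) auto
  qed
  obtain u where u: "\<And>l. l \<in> I \<Longrightarrow> (\<Sum>i\<in>I. A l i * u i) = b l"
    using solvable[of b] by blast
  obtain v where v: "\<And>l. l \<in> I \<Longrightarrow> (\<Sum>i\<in>I. A l i * v i) = A l a"
    using solvable[of "\<lambda>l. A l a"] by blast
  define s where "s = A a a - (\<Sum>i\<in>I. A a i * v i)"
  have sum_upd: "(\<Sum>i\<in>insert a I. A l i * (if i = a then d else x i)) =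
      A l a * d + (\<Sum>i\<in>I. A l i * x i)" for l d x
  proof -
    have "(\<Sum>i\<in>I. A l i * (if i = a then d else x i)) = (\<Sum>i\<in>I. A l i * x i)"
      using insert.hyps by (intro sum.cong) auto
    then show ?thesis using insert.hyps by simp
  qed
  have "s \<noteq> 0"
  proof
    assume "s = 0"
    then have "(\<Sum>i\<in>insert a I. A l i * (if i = a then 1 else - v i)) = 0" if "l \<in> insert a I" for l
      unfolding sum_upd using that v by (auto simp: s_def sum_negf)
    then have "(if a = a then 1 else - v a) = 0"
      by (rule insert.prems[OF subset_refl, of "\<lambda>i. if i = a then 1 else - v i" a]) auto
    then show False by simp
  qed
  define d where "d = (b a - (\<Sum>i\<in>I. A a i * u i)) / s"
  have "(\<Sum>i\<in>insert a I. A l i * (if i = a then d else u i - d * v i)) = b l"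
    if "l \<in> insert a I" for l
  proof -
    have "(\<Sum>i\<in>insert a I. A l i * (if i = a then d else u i - d * v i)) =
        A l a * d + ((\<Sum>i\<in>I. A l i * u i) - d * (\<Sum>i\<in>I. A l i * v i))"
      unfolding sum_upd by (simp add: algebra_simps sum_subtractf sum_distrib_left)
    also have "\<dots> = b l"
    proof (cases "l = a")
      case True
      have "A a a * d + ((\<Sum>i\<in>I. A a i * u i) - d * (\<Sum>i\<in>I. A a i * v i)) =
          d * s + (\<Sum>i\<in>I. A a i * u i)"
        by (simp add: s_def algebra_simps)
      also have "d * s = b a - (\<Sum>i\<in>I. A a i * u i)"
        using \<open>s \<noteq> 0\<close> by (simp add: d_def)
      finally show ?thesis using True by simp
    next
      case False
      then show ?thesis using that u v by simp
    qed
    finally show ?thesis .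
  qed
  then show ?case
    by (intro exI[of _ "\<lambda>i. if i = a then d else u i - d * v i"]) simp
qed

lemma vector_linear_system_unique_solution:
  fixes A :: "nat \<Rightarrow> nat \<Rightarrow> real" and b :: "nat \<Rightarrow> real ^ 'd"
  assumes "finite I"
    and ker: "\<And>J x. J \<subseteq> I \<Longrightarrow> (\<And>l. l \<in> J \<Longrightarrow> (\<Sum>i\<in>J. A l i * x i) = 0) \<Longrightarrow> (\<And>i. i \<in> J \<Longrightarrow> x i = 0)"
  shows "\<exists>!q. q \<in> I \<rightarrow>\<^sub>E UNIV \<and> (\<forall>l\<in>I. (\<Sum>i\<in>I. A l i *\<^sub>R q i) = b l)"
proof (rule ex_ex1I)
  have "\<forall>e. \<exists>x. \<forall>l\<in>I. (\<Sum>i\<in>I. A l i * x i) = b l $ e"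
  proof
    fix e
    show "\<exists>x. \<forall>l\<in>I. (\<Sum>i\<in>I. A l i * x i) = b l $ e"
    proof (rule linear_system_solvable[OF \<open>finite I\<close>])
      fix J x i
      assume "J \<subseteq> I" "\<And>l. l \<in> J \<Longrightarrow> (\<Sum>i\<in>J. A l i * x i) = 0" "i \<in> J"
      then show "x i = 0" by (rule ker[of J x i])
    qed
  qed
  then obtain x where x: "\<And>e l. l \<in> I \<Longrightarrow> (\<Sum>i\<in>I. A l i * x e i) = b l $ e"
    by metis
  have "(\<Sum>i\<in>I. A l i *\<^sub>R restrict (\<lambda>i. \<chi> e. x e i) I i) = b l" if "l \<in> I" for l
    using x that by (simp add: vec_eq_iff)
  then show "\<exists>q. q \<in> I \<rightarrow>\<^sub>E UNIV \<and> (\<forall>l\<in>I. (\<Sum>i\<in>I. A l i *\<^sub>R q i) = b l)"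
    by (intro exI[of _ "restrict (\<lambda>i. \<chi> e. x e i) I"]) simp
next
  fix q q' :: "nat \<Rightarrow> real ^ 'd"
  assume q: "q \<in> I \<rightarrow>\<^sub>E UNIV \<and> (\<forall>l\<in>I. (\<Sum>i\<in>I. A l i *\<^sub>R q i) = b l)"
    and q': "q' \<in> I \<rightarrow>\<^sub>E UNIV \<and> (\<forall>l\<in>I. (\<Sum>i\<in>I. A l i *\<^sub>R q' i) = b l)"
  have "q i = q' i" if "i \<in> I" for i
  proof -
    have "(\<Sum>i\<in>I. A l i * (q i $ e - q' i $ e)) = 0" if "l \<in> I" for l e
    proof -
      have "(\<Sum>i\<in>I. A l i *\<^sub>R q i) $ e = (\<Sum>i\<in>I. A l i *\<^sub>R q' i) $ e"
        using q q' that by simp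
      then show ?thesis by (simp add: right_diff_distrib sum_subtractf)
    qed
    then have "q i $ e - q' i $ e = 0" for e
      by (rule ker[OF subset_refl, of "\<lambda>i. q i $ e - q' i $ e" i]) (use that in auto)
    then show ?thesis by (simp add: vec_eq_iff)
  qed
  then show "q = q'"
    using q q' by (intro PiE_ext[of q I _ q']) auto
qed

section \<open>Normal equations of weighted least squares\<close>

text \<open>
  The factor \<open>m choose i\<close> occurs in the columns only, which makes the matrix unsymmetric.
  Absorbing it into the unknowns (\<open>y\<close> below) leaves the symmetric matrix \<open>g\<close> of the quadratic
  form.
\<close>

lemma bernstein_system_unique_solution:
  fixes c :: "nat \<Rightarrow> real" and b :: "nat \<Rightarrow> real ^ 'd"
  assumes I: "I \<subseteq> {..m}" and c: "\<And>j. j \<le> r \<Longrightarrow> c j > 0"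
  shows "\<exists>!q. q \<in> I \<rightarrow>\<^sub>E UNIV \<and>
    (\<forall>l\<in>I. (\<Sum>i\<in>I. \<Sum>j = 0..r.
       (real (r choose j) * real (m choose i) / real ((2*m + r) choose (i + j + l)) * c j) *\<^sub>R q i)
     = b l)"
proof -
  define g where "g l i = (\<Sum>j\<le>r. real (r choose j) * c j / real ((2*m + r) choose (i + j + l)))" for l i
  have "\<exists>!q. q \<in> I \<rightarrow>\<^sub>E UNIV \<and> (\<forall>l\<in>I. (\<Sum>i\<in>I. (g l i * real (m choose i)) *\<^sub>R q i) = b l)"
  proof (rule vector_linear_system_unique_solution)
    show "finite I" using I finite_subset by blast
    fix J x i
    assume "J \<subseteq> I" and i: "i \<in> J"
      and zero: "\<And>l. l \<in> J \<Longrightarrow> (\<Sum>i\<in>J. (g l i * real (m choose i)) * x i) = 0"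
    define y where "y i = real (m choose i) * x i" for i
    have J: "J \<subseteq> {..m}" using \<open>J \<subseteq> I\<close> I by blast
    have "(\<Sum>i\<in>J. y l * y i * g l i) = 0" if "l \<in> J" for l
    proof -
      have "(\<Sum>i\<in>J. y l * y i * g l i) = y l * (\<Sum>i\<in>J. (g l i * real (m choose i)) * x i)"
        by (simp add: sum_distrib_left y_def mult_ac)
      then show ?thesis using zero that by simp
    qed
    then have "(\<Sum>l\<in>J. \<Sum>i\<in>J. y l * y i * g l i) = 0" by simp
    then have "y i = 0"
      unfolding g_def by (rule bernstein_quadratic_form_eq_0[OF J c, rotated]) (use i in auto)
    then show "x i = 0"
      using J i by (auto simp: y_def)
  qed
  moreover have "(\<Sum>j = 0..r. (real (r choose j) * real (m choose i) /
        real ((2*m + r) choose (i + j + l)) * c j) *\<^sub>R v) = (g l i * real (m choose i)) *\<^sub>R v"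
    for i l and v :: "real ^ 'd"
    by (simp add: g_def sum_distrib_left mult_ac atLeast0AtMost flip: scaleR_sum_left)
  ultimately show ?thesis by (simp only:)
qed

lemma sq_weight_pos:
  assumes "\<And>i. i \<le> n \<Longrightarrow> \<omega> i > 0" and "i \<le> 2 * n"
  shows "sq_weight n \<omega> i > 0"
  unfolding sq_weight_def using assms
  by (intro sum_pos mult_pos_pos divide_pos_pos) auto

theorem mainTheorem1:
  fixes n m k h :: nat
    and p :: "nat \<Rightarrow> real ^ 'd"
    and \<omega> :: "nat \<Rightarrow> real"
  assumes "n \<ge> 2" and "m \<ge> 1"
    and "\<And>i. i \<le> n \<Longrightarrow> \<omega> i > 0"
    and "\<omega> 0 = 1" and "\<omega> n = 1"
    and "k = left_order m" and "h = right_order m"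
  shows
    "(\<exists>!q. q \<in> {k+1..m-h-1} \<rightarrow>\<^sub>E (UNIV :: (real ^ 'd) set) \<and>
       (\<forall>l \<in> {k+1..m-h-1}.
         (\<Sum>i = k+1..m-h-1. \<Sum>j = 0..n.
            (real (n choose j) * real (m choose i) / real ((2*m + n) choose (i + j + l)) * \<omega> j)
              *\<^sub>R q i)
         = (real (2*m + n + 1) / real (m + n + 1)) *\<^sub>R
             (\<Sum>i = 0..n. (real (n choose i) / real ((m + n) choose (i + l)) * \<omega> i) *\<^sub>R p i)
           - (\<Sum>i = 0..k. \<Sum>j = 0..n.
               (real (n choose j) * real (m choose i) / real ((2*m + n) choose (i + j + l)) * \<omega> j)
                 *\<^sub>R fixed_ctrl_pt n m \<omega> p i)
           - (\<Sum>i = m-h..m. \<Sum>j = 0..n.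
               (real (n choose j) * real (m choose i) / real ((2*m + n) choose (i + j + l)) * \<omega> j)
                 *\<^sub>R fixed_ctrl_pt n m \<omega> p i)))
     \<and>
     (\<exists>!q. q \<in> {k+1..m-h-1} \<rightarrow>\<^sub>E (UNIV :: (real ^ 'd) set) \<and>
       (\<forall>l \<in> {k+1..m-h-1}.
         (\<Sum>i = k+1..m-h-1. \<Sum>j = 0..2*n.
            (real ((2*n) choose j) * real (m choose i) / real ((2*n + 2*m) choose (i + j + l))
              * sq_weight n \<omega> j) *\<^sub>R q i)
         = (real (2*m + 2*n + 1) / real (m + 2*n + 1)) *\<^sub>R
             (\<Sum>i = 0..n. \<Sum>j = 0..n.
               (real (n choose i) * real (n choose j) / real ((2*n + m) choose (i + j + l))
                 * \<omega> i * \<omega> j) *\<^sub>R p i)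
           - (\<Sum>i = 0..k. \<Sum>j = 0..2*n.
               (real ((2*n) choose j) * real (m choose i) / real ((2*n + 2*m) choose (i + j + l))
                 * sq_weight n \<omega> j) *\<^sub>R fixed_ctrl_pt n m \<omega> p i)
           - (\<Sum>i = m-h..m. \<Sum>j = 0..2*n.
               (real ((2*n) choose j) * real (m choose i) / real ((2*n + 2*m) choose (i + j + l))
                 * sq_weight n \<omega> j) *\<^sub>R fixed_ctrl_pt n m \<omega> p i)))"
proof -
  let ?I = "{k+1..m-h-1}"
  have I: "?I \<subseteq> {..m}" by auto
  have N: "2 * n + 2 * m = 2 * m + 2 * n" by simp
  show ?thesis
    unfolding N
    by (intro conjI bernstein_system_unique_solution[OF I] sq_weight_pos assms(3))
qed

end
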